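(* Let $\phi=\tilde p/p$ be an irreducible rational inner function on $\mathbb{D}^3$ of degree $(m,n,1)$ with $p(z)=p_1(z_1,z_2)+z_3p_2(z_1,z_2)$, $\tilde p(z)=z_3\tilde p_1(z_1,z_2)+\tilde p_2(z_1,z_2)$, and assume $\mathcal{Z}_p\cap\mathbb{T}^3$ is finite. Fix $\lambda\in\mathbb{T}$, let $q_\lambda=\lambda p_1-\tilde p_2$ and $\Psi_\lambda=\bar\lambda\,q_\lambda/\tilde q_\lambda$. Then: (A) if there is $\tau\in\mathcal{Z}_p\cap\mathbb{T}^3$ with $\phi^*(\tau)=\lambda$, then $1/\Psi_\lambda$ has a singularity at $(\tau_1,\tau_2)\in\mathbb{T}^2$; (B) if there is no $\tau\in\mathcal{Z}_p\cap\mathbb{T}^3$ with $\phi^*(\tau)=\lambda$, then $1/\Psi_\lambda$ is continuous on $\overline{\mathbb{D}^2}$.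
   Context: A rational inner function (RIF) on $\mathbb{D}^3$ is a rational function holomorphic on the tridisk with unimodular radial limits a.e. on $\mathbb{T}^3$; it is written $\phi=\tilde p/p$ with $p$ zero-free on $\mathbb{D}^3$, $p,\tilde p$ without common factors. For degree $(m,n,1)$, $\tilde p(z)=z_1^mz_2^nz_3\overline{p(1/\bar z_1,1/\bar z_2,1/\bar z_3)}$, and reflections of two-variable polynomials are taken with respect to $(m,n)$: $\tilde q(z_1,z_2)=z_1^mz_2^n\overline{q(1/\bar z_1,1/\bar z_2)}$. $\phi^*(\tau)$ is the nontangential limit of $\phi$ at $\tau\in\mathbb{T}^3$ (limit as $z\to\tau$ in $\mathbb{D}^3$ with $\|z-\tau\|\le C(1-\|z\|)$), which exists at every point. A singularity of a two-variable RIF $q_\lambda^{-1}\lambda\tilde q_\lambda$ at a point of $\mathbb{T}^2$ means a common zero of numerator and denominator there (the function is not continuous there). $\mathcal{Z}_p$ is the zero set of $p$. *)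

theory Defs
  imports "HOL-Analysis.Analysis"
begin

type_synonym c3 = "complex \<times> complex \<times> complex"

definition poly2 :: "nat \<Rightarrow> nat \<Rightarrow> (nat \<Rightarrow> nat \<Rightarrow> complex) \<Rightarrow> complex \<Rightarrow> complex \<Rightarrow> complex" where
  "poly2 m n c z1 z2 = (\<Sum>i\<le>m. \<Sum>j\<le>n. c i j * z1 ^ i * z2 ^ j)"

text \<open>Coefficients of the reflection q~(z1,z2) = z1^m z2^n conj(q(1/conj z1, 1/conj z2))
  of a polynomial with coefficients c, taken with respect to (m,n).\<close>
definition refl2 :: "nat \<Rightarrow> nat \<Rightarrow> (nat \<Rightarrow> nat \<Rightarrow> complex) \<Rightarrow> nat \<Rightarrow> nat \<Rightarrow> complex" where
  "refl2 m n c i j = cnj (c (m - i) (n - j))"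

definition pP :: "nat \<Rightarrow> nat \<Rightarrow> (nat \<Rightarrow> nat \<Rightarrow> complex) \<Rightarrow> (nat \<Rightarrow> nat \<Rightarrow> complex) \<Rightarrow> c3 \<Rightarrow> complex" where
  "pP m n a b z = poly2 m n a (fst z) (fst (snd z)) + snd (snd z) * poly2 m n b (fst z) (fst (snd z))"

definition pPt :: "nat \<Rightarrow> nat \<Rightarrow> (nat \<Rightarrow> nat \<Rightarrow> complex) \<Rightarrow> (nat \<Rightarrow> nat \<Rightarrow> complex) \<Rightarrow> c3 \<Rightarrow> complex" where
  "pPt m n a b z = snd (snd z) * poly2 m n (refl2 m n a) (fst z) (fst (snd z))
                   + poly2 m n (refl2 m n b) (fst z) (fst (snd z))"

definition qcoef :: "nat \<Rightarrow> nat \<Rightarrow> (nat \<Rightarrow> nat \<Rightarrow> complex) \<Rightarrow> (nat \<Rightarrow> nat \<Rightarrow> complex) \<Rightarrow> complex \<Rightarrow> nat \<Rightarrow> nat \<Rightarrow> complex" where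
  "qcoef m n a b lam i j = lam * a i j - refl2 m n b i j"

definition polydisc3 :: "c3 set" where
  "polydisc3 = {z. norm (fst z) < 1 \<and> norm (fst (snd z)) < 1 \<and> norm (snd (snd z)) < 1}"

definition torus3 :: "c3 set" where
  "torus3 = {z. norm (fst z) = 1 \<and> norm (fst (snd z)) = 1 \<and> norm (snd (snd z)) = 1}"

definition closed_bidisc :: "(complex \<times> complex) set" where
  "closed_bidisc = {w. norm (fst w) \<le> 1 \<and> norm (snd w) \<le> 1}"

definition maxnorm3 :: "c3 \<Rightarrow> real" where
  "maxnorm3 z = max (norm (fst z)) (max (norm (fst (snd z))) (norm (snd (snd z))))"

definition nt_region :: "c3 \<Rightarrow> real \<Rightarrow> c3 set" where
  "nt_region \<tau> C = {z \<in> polydisc3. maxnorm3 (z - \<tau>) \<le> C * (1 - maxnorm3 z)}"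

definition has_nt_limit :: "(c3 \<Rightarrow> complex) \<Rightarrow> c3 \<Rightarrow> complex \<Rightarrow> bool" where
  "has_nt_limit f \<tau> L \<longleftrightarrow> (\<forall>C>0. (f \<longlongrightarrow> L) (at \<tau> within nt_region \<tau> C))"

text \<open>Polynomial functions on C^3 (the polynomial ring C[z1,z2,z3], identified with
  polynomial functions since C is infinite).\<close>
definition poly3_fun :: "(c3 \<Rightarrow> complex) \<Rightarrow> bool" where
  "poly3_fun f \<longleftrightarrow> (\<exists>N c. \<forall>z1 z2 z3. f (z1, z2, z3) =
      (\<Sum>i\<le>N. \<Sum>j\<le>N. \<Sum>k\<le>N. c i j k * z1 ^ i * z2 ^ j * z3 ^ k))"

definition const_fun :: "(c3 \<Rightarrow> complex) \<Rightarrow> bool" where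
  "const_fun f \<longleftrightarrow> (\<exists>c. \<forall>z. f z = c)"

definition poly3_dvd :: "(c3 \<Rightarrow> complex) \<Rightarrow> (c3 \<Rightarrow> complex) \<Rightarrow> bool" where
  "poly3_dvd f g \<longleftrightarrow> (\<exists>h. poly3_fun h \<and> (\<forall>z. g z = f z * h z))"

definition poly3_irreducible :: "(c3 \<Rightarrow> complex) \<Rightarrow> bool" where
  "poly3_irreducible p \<longleftrightarrow> poly3_fun p \<and> \<not> const_fun p \<and>
     (\<forall>f g. poly3_fun f \<and> poly3_fun g \<and> (\<forall>z. p z = f z * g z) \<longrightarrow> const_fun f \<or> const_fun g)"

definition poly3_no_common_factor :: "(c3 \<Rightarrow> complex) \<Rightarrow> (c3 \<Rightarrow> complex) \<Rightarrow> bool" where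
  "poly3_no_common_factor p q \<longleftrightarrow>
     (\<forall>f. poly3_fun f \<and> poly3_dvd f p \<and> poly3_dvd f q \<longrightarrow> const_fun f)"

end

theory Submission
  imports Defs "HOL-Complex_Analysis.Complex_Analysis"
begin

text \<open>
  The level set is a pencil: \<open>\<lambda> p - p~ = q - z3 \<lambda> q~\<close>.  If \<open>\<phi>\<close> has nontangential limit \<open>\<lambda>\<close> at a
  zero \<open>\<tau>\<close> of \<open>p\<close>, then \<open>\<lambda> p - p~\<close> vanishes to second order along two rays that differ only in the
  \<open>z3\<close>-direction, so its \<open>z3\<close>-derivative \<open>-\<lambda> q~\<close> vanishes at \<open>(\<tau>1, \<tau>2)\<close>; this gives (A).
  Conversely, let \<open>q\<close> vanish at a point of the 2-torus. Finiteness yields \<open>\<tau>3 = -p1/p2\<close> on the circle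
  with \<open>p(\<tau>) = 0\<close>. Comparing \<open>\<bar>p2\<bar> \<le> \<bar>p1\<bar>\<close> and \<open>\<bar>p2~\<bar> \<le> \<bar>p1\<bar>\<close> to first order at the boundary contact
  point shows that the gradient of \<open>p\<close> has aligned components (so \<open>\<bar>p\<bar>\<close> is bounded below by
  the distance to \<open>\<tau>\<close> nontangentially) and, with the reflection identity, that the gradient of
  \<open>\<lambda> p - p~\<close> vanishes; hence \<open>\<lambda>\<close> is the nontangential limit at \<open>\<tau>\<close>.  In case (B), therefore,
  \<open>q\<close> has no zeros on the 2-torus, and Hurwitz's theorem excludes zeros from the closed bidisc.
\<close>

section \<open>Reflection and first-order calculus of polynomials in two variables\<close>

lemma poly2_refl2:
  assumes "z1 \<noteq> 0" "z2 \<noteq> 0"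
  shows "poly2 m n (refl2 m n c) z1 z2
       = z1 ^ m * z2 ^ n * cnj (poly2 m n c (1 / cnj z1) (1 / cnj z2))"
proof -
  \<comment> \<open>Both summation indices are reversed; the ranges are read as indices below
    \<open>Suc m\<close> and \<open>Suc n\<close> to fit the reindexing rule.\<close>
  have "poly2 m n (refl2 m n c) z1 z2
      = (\<Sum>i\<le>m. \<Sum>j\<le>n. cnj (c i j) * z1 ^ (m - i) * z2 ^ (n - j))"
    unfolding poly2_def refl2_def
    by (subst sum.nat_diff_reindex[symmetric, where n = "Suc m", unfolded lessThan_Suc_atMost],
        subst (2) sum.nat_diff_reindex[symmetric, where n = "Suc n", unfolded lessThan_Suc_atMost])
       (auto intro!: sum.cong)
  also have "\<dots> = (\<Sum>i\<le>m. \<Sum>j\<le>n. z1 ^ m * z2 ^ n * (cnj (c i j) * (1 / z1) ^ i * (1 / z2) ^ j))"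
    using assms by (intro sum.cong refl) (auto simp: power_diff power_one_over field_simps)
  also have "\<dots> = z1 ^ m * z2 ^ n * cnj (poly2 m n c (1 / cnj z1) (1 / cnj z2))"
    unfolding poly2_def by (simp add: sum_distrib_left)
  finally show ?thesis .
qed

lemma inverse_cnj_unit:
  assumes "norm z = 1"
  shows "1 / cnj z = z"
  using assms complex_norm_square[of z] by (cases "z = 0") (auto simp: divide_eq_eq)

lemma poly2_refl2_torus:
  assumes "norm z1 = 1" "norm z2 = 1"
  shows "poly2 m n (refl2 m n c) z1 z2 = z1 ^ m * z2 ^ n * cnj (poly2 m n c z1 z2)"
proof -
  have "z1 \<noteq> 0" "z2 \<noteq> 0" using assms by auto
  then show ?thesis by (simp add: poly2_refl2 inverse_cnj_unit assms)
qed

lemma norm_poly2_refl2_torus: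
  assumes "norm z1 = 1" "norm z2 = 1"
  shows "norm (poly2 m n (refl2 m n c) z1 z2) = norm (poly2 m n c z1 z2)"
  using assms by (simp add: poly2_refl2_torus norm_mult norm_power)

lemma poly2_qcoef:
  "poly2 m n (qcoef m n a b l) z1 z2 = l * poly2 m n a z1 z2 - poly2 m n (refl2 m n b) z1 z2"
  unfolding poly2_def qcoef_def sum_distrib_left sum_subtractf[symmetric]
  by (simp add: algebra_simps)

text \<open>Reflection is conjugate linear and an involution on indices up to \<open>(m, n)\<close>,
  so \<open>p2~\<close> reflects back to \<open>p2\<close>. Truncated subtraction confines the
  coefficient identity to the summation range.\<close>

lemma poly2_refl2_qcoef:
  "poly2 m n (refl2 m n (qcoef m n a b l)) z1 z2
    = cnj l * poly2 m n (refl2 m n a) z1 z2 - poly2 m n b z1 z2"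
  unfolding poly2_def qcoef_def refl2_def sum_distrib_left sum_subtractf[symmetric]
  by (intro sum.cong refl) (simp add: algebra_simps)

lemma continuous_on_poly2 [continuous_intros]:
  assumes "continuous_on S f" "continuous_on S g"
  shows "continuous_on S (\<lambda>x. poly2 m n c (f x) (g x))"
  unfolding poly2_def by (intro continuous_intros assms)

lemma tendsto_poly2 [tendsto_intros]:
  assumes "(f \<longlongrightarrow> x) F" "(g \<longlongrightarrow> y) F"
  shows "((\<lambda>t. poly2 m n c (f t) (g t)) \<longlongrightarrow> poly2 m n c x y) F"
  unfolding poly2_def by (intro tendsto_intros assms)

lemma holomorphic_on_poly2 [holomorphic_intros]:
  assumes "f holomorphic_on S" "g holomorphic_on S"
  shows "(\<lambda>z. poly2 m n c (f z) (g z)) holomorphic_on S"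
  unfolding poly2_def by (intro holomorphic_intros assms)

text \<open>Later arguments compare gradients through their complex components, so existence of two
  such components suffices and no formula for them is kept.\<close>

lemma poly2_has_derivative_ex:
  "\<exists>d1 d2. ((\<lambda>w. poly2 m n c (fst w) (snd w)) has_derivative (\<lambda>v. d1 * fst v + d2 * snd v)) (at w0)"
proof -
  have pw: "((\<lambda>w. f w ^ i) has_derivative (\<lambda>v. of_nat i * f w0 ^ (i - 1) * f v)) (at w0)"
    if "bounded_linear f" for f :: "complex \<times> complex \<Rightarrow> complex" and i
    using has_derivative_power[OF bounded_linear.has_derivative[OF that has_derivative_ident], where x = w0 and S = UNIV and n = i]
    by (simp add: ac_simps)
  have "((\<lambda>w. poly2 m n c (fst w) (snd w)) has_derivative
     (\<lambda>v. \<Sum>i\<le>m. \<Sum>j\<le>n. (c i j * fst w0 ^ i) * (of_nat j * snd w0 ^ (j - 1) * snd v)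
                + (c i j * (of_nat i * fst w0 ^ (i - 1) * fst v)) * snd w0 ^ j)) (at w0)"
    unfolding poly2_def
    by (intro has_derivative_sum has_derivative_mult has_derivative_mult_right pw
        bounded_linear_fst bounded_linear_snd)
  also have "(\<lambda>v. \<Sum>i\<le>m. \<Sum>j\<le>n. (c i j * fst w0 ^ i) * (of_nat j * snd w0 ^ (j - 1) * snd v)
                + (c i j * (of_nat i * fst w0 ^ (i - 1) * fst v)) * snd w0 ^ j)
     = (\<lambda>v. (\<Sum>i\<le>m. \<Sum>j\<le>n. c i j * (of_nat i * fst w0 ^ (i - 1)) * snd w0 ^ j) * fst v
          + (\<Sum>i\<le>m. \<Sum>j\<le>n. c i j * fst w0 ^ i * (of_nat j * snd w0 ^ (j - 1))) * snd v)"
    unfolding sum_distrib_right sum.distrib[symmetric] by (simp add: algebra_simps)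
  finally show ?thesis by blast
qed

section \<open>Maximum principle and propagation of zeros on the bidisc\<close>

lemma maximum_modulus_cball:
  assumes "f holomorphic_on cball 0 1" "\<And>z. norm z = 1 \<Longrightarrow> norm (f z) \<le> B" "norm (w :: complex) \<le> 1"
  shows "norm (f w) \<le> B"
proof (rule maximum_modulus_frontier[where S = "cball 0 1" and f = f])
  show "f holomorphic_on interior (cball 0 1)"
    using assms(1) by (rule holomorphic_on_subset) auto
  show "continuous_on (closure (cball 0 1)) f"
    using holomorphic_on_imp_continuous_on[OF assms(1)] by simp
qed (use assms in auto)

text \<open>The maximum principle is applied to dilates, since \<open>a\<close> may vanish on the boundary.\<close>

lemma refl2_dominated:
  assumes nz: "\<And>z1 z2. norm z1 < 1 \<Longrightarrow> norm z2 < 1 \<Longrightarrow> poly2 m n a z1 z2 \<noteq> 0"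
    and le: "\<And>z1 z2. norm z1 < 1 \<Longrightarrow> norm z2 < 1 \<Longrightarrow> norm (poly2 m n b z1 z2) \<le> norm (poly2 m n a z1 z2)"
    and w: "norm w1 < 1" "norm w2 < 1"
  shows "norm (poly2 m n (refl2 m n b) w1 w2) \<le> norm (poly2 m n a w1 w2)"
proof -
  have bd: "norm (of_real r ^ (m + n) * poly2 m n (refl2 m n b) (w1 / of_real r) (w2 / of_real r))
          \<le> norm (poly2 m n a (of_real r * w1) (of_real r * w2))"
    if r: "0 < r" "r < 1" for r :: real
  proof -
    \<comment> \<open>On the 2-torus \<open>1 / cnj (z / r) = r z\<close>, so the reflection at
      \<open>z / r\<close> has the modulus of \<open>b\<close> at \<open>r z\<close>, up to powers
      of \<open>r\<close> which the factor \<open>r ^ (m + n)\<close> cancels. At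
      \<open>r z\<close>, inside the open bidisc, \<open>b\<close> is dominated by
      \<open>a\<close>.\<close>
    define H where "H = (\<lambda>z1 z2. of_real r ^ (m + n) * poly2 m n (refl2 m n b) (z1 / of_real r) (z2 / of_real r)
        / poly2 m n a (of_real r * z1) (of_real r * z2))"
    have small: "norm (of_real r * z) < 1" if "norm z \<le> 1" for z :: complex
    proof -
      have "r * norm z \<le> r * 1" using that r by (intro mult_left_mono) auto
      also have "\<dots> < 1" using r by simp
      finally show ?thesis using r by (simp add: norm_mult)
    qed
    have nz': "poly2 m n a (of_real r * z1) (of_real r * z2) \<noteq> 0" if "norm z1 \<le> 1" "norm z2 \<le> 1" for z1 z2
      by (intro nz small that)
    have torus: "norm (H z1 z2) \<le> 1" if z: "norm z1 = 1" "norm z2 = 1" for z1 z2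
    proof -
      have z0: "z1 / of_real r \<noteq> 0" "z2 / of_real r \<noteq> 0" using z r by auto
      have e: "1 / cnj (z / of_real r) = of_real r * z" if "norm z = 1" for z :: complex
      proof -
        have "1 / cnj (z / of_real r) = of_real r * (1 / cnj z)" by simp
        then show ?thesis using inverse_cnj_unit[OF that] by simp
      qed
      have "norm (of_real r ^ (m + n) * poly2 m n (refl2 m n b) (z1 / of_real r) (z2 / of_real r))
          = norm (poly2 m n b (of_real r * z1) (of_real r * z2))"
        unfolding poly2_refl2[OF z0] e[OF z(1)] e[OF z(2)] using z r
        by (simp add: norm_mult norm_power norm_divide power_add power_divide)
      also have "\<dots> \<le> norm (poly2 m n a (of_real r * z1) (of_real r * z2))"
        using z by (intro le small) auto
      finally show ?thesis using nz'[of z1 z2] z unfolding H_def by (simp add: norm_divide divide_le_eq)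
    qed
    have hol1: "(\<lambda>z. H z z2) holomorphic_on cball 0 1" if "norm z2 \<le> 1" for z2
      unfolding H_def using that r by (intro holomorphic_intros nz') auto
    have hol2: "(\<lambda>z. H z1 z) holomorphic_on cball 0 1" if "norm z1 \<le> 1" for z1
      unfolding H_def using that r by (intro holomorphic_intros nz') auto
    \<comment> \<open>The bound on the 2-torus moves inward one variable at a time: first
      \<open>z1\<close> with \<open>z2\<close> on the circle, then \<open>z2\<close>.\<close>
    have "norm (H w1 z2) \<le> 1" if "norm z2 = 1" for z2
      using maximum_modulus_cball[OF hol1] torus that w by (metis less_imp_le order_refl)
    then have "norm (H w1 w2) \<le> 1"
      using maximum_modulus_cball[OF hol2] w by (metis less_imp_le)
    then show ?thesis
      using nz'[of w1 w2] w unfolding H_def by (simp add: norm_divide divide_le_eq)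
  qed
  have "((\<lambda>r. norm (of_real r ^ (m + n) * poly2 m n (refl2 m n b) (w1 / of_real r) (w2 / of_real r)))
      \<longlongrightarrow> norm (of_real 1 ^ (m + n) * poly2 m n (refl2 m n b) (w1 / of_real 1) (w2 / of_real 1))) (at_left (1::real))"
    by (intro tendsto_intros) auto
  moreover have "((\<lambda>r. norm (poly2 m n a (of_real r * w1) (of_real r * w2)))
      \<longlongrightarrow> norm (poly2 m n a (of_real 1 * w1) (of_real 1 * w2))) (at_left (1::real))"
    by (intro tendsto_intros)
  moreover have "eventually (\<lambda>r. r \<in> {0<..<1}) (at_left (1::real))"
    by (rule eventually_at_left_real) simp
  then have "eventually (\<lambda>r. norm (of_real r ^ (m + n) * poly2 m n (refl2 m n b) (w1 / of_real r) (w2 / of_real r))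
          \<le> norm (poly2 m n a (of_real r * w1) (of_real r * w2))) (at_left (1::real))"
    by eventually_elim (use bd in auto)
  ultimately have "norm (of_real 1 ^ (m + n) * poly2 m n (refl2 m n b) (w1 / of_real 1) (w2 / of_real 1))
       \<le> norm (poly2 m n a (of_real 1 * w1) (of_real 1 * w2))"
    by (intro tendsto_le[OF trivial_limit_at_left_real])
  then show ?thesis by simp
qed

text \<open>Uniform continuity on the compact cylinder makes \<open>h (1, _)\<close> a uniform limit
  of zero-free functions. By Hurwitz it is zero-free or constant on the open disc; the zero
  \<open>z0\<close> forces the constant 0, and continuity extends this to the circle.\<close>

lemma Hurwitz_homotopy:
  fixes h :: "real \<times> complex \<Rightarrow> complex"
  assumes cont: "continuous_on ({0..1} \<times> cball 0 1) h"
    and hol: "\<And>t. t \<in> {0..1} \<Longrightarrow> (\<lambda>z. h (t, z)) holomorphic_on ball 0 1"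
    and nz: "\<And>t z. 0 \<le> t \<Longrightarrow> t < 1 \<Longrightarrow> norm z < 1 \<Longrightarrow> h (t, z) \<noteq> 0"
    and z0: "norm z0 < 1" "h (1, z0) = 0" and z: "norm z \<le> 1"
  shows "h (1, z) = 0"
proof -
  define t where "t = (\<lambda>k::nat. 1 - inverse (real (Suc k)))"
  have t: "0 \<le> t k" "t k < 1" for k by (auto simp: t_def field_simps)
  have "(\<lambda>k. 1 - inverse (real (Suc k))) \<longlonglongrightarrow> 1 - 0"
    by (intro tendsto_intros LIMSEQ_inverse_real_of_nat)
  then have tl: "t \<longlonglongrightarrow> 1" by (simp add: t_def)
  have uc: "uniformly_continuous_on ({0..1} \<times> cball 0 1) h"
    by (intro compact_uniformly_continuous cont compact_Times) auto
  have ul: "uniform_limit (ball 0 1) (\<lambda>k z. h (t k, z)) (\<lambda>z. h (1, z)) sequentially"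
  proof (rule uniform_limitI)
    fix e :: real assume "0 < e"
    then obtain d where d: "d > 0"
      "\<And>x x'. x \<in> {0..1} \<times> cball 0 1 \<Longrightarrow> x' \<in> {0..1} \<times> cball 0 1 \<Longrightarrow> dist x' x < d \<Longrightarrow> dist (h x') (h x) < e"
      using uc unfolding uniformly_continuous_on_def by meson
    have "eventually (\<lambda>k. dist (t k) 1 < d) sequentially"
      using tl d(1) by (rule tendstoD)
    then show "\<forall>\<^sub>F k in sequentially. \<forall>z\<in>ball 0 1. dist (h (t k, z)) (h (1, z)) < e"
    proof eventually_elim
      case (elim k)
      show ?case
        using elim t[of k] by (intro ballI d(2)) (auto simp: dist_Pair_Pair less_imp_le)
    qed
  qed
  have nzt: "h (t k, z) \<noteq> 0" if "norm z < 1" for k z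
    using nz t that by blast
  have "(\<lambda>z. h (1, z)) constant_on ball 0 1"
  proof (rule ccontr)
    assume nc: "\<not> (\<lambda>z. h (1, z)) constant_on ball 0 1"
    have "h (1, z0) \<noteq> 0"
      by (rule Hurwitz_no_zeros[where S = "ball 0 1" and \<F> = "\<lambda>k z. h (t k, z)" and g = "\<lambda>z. h (1, z)"])
         (use nc t z0 in \<open>auto intro!: hol less_imp_le uniform_limit_on_subset[OF ul] simp: nzt\<close>)
    then show False using z0 by simp
  qed
  then obtain k where k: "\<And>z. norm z < 1 \<Longrightarrow> h (1, z) = k" unfolding constant_on_def by auto
  then have "k = 0" using z0 by metis
  have "continuous_on (cball 0 1) (\<lambda>z. h (1, z))"
    by (rule continuous_on_compose2[OF cont]) (auto intro!: continuous_intros)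
  then show ?thesis
    using continuous_constant_on_closure[of "ball 0 1" "\<lambda>z. h (1, z)" 0 z] k \<open>k = 0\<close> z by auto
qed

text \<open>Hurwitz for \<open>F(z, t w) - t G(z, t w)\<close> as \<open>t\<close> tends to 1: this is zero-free on the disc for \<open>t < 1\<close>.\<close>

lemma zero_propagates:
  fixes F G :: "complex \<Rightarrow> complex \<Rightarrow> complex"
  assumes cF: "continuous_on UNIV (\<lambda>w. F (fst w) (snd w))" and cG: "continuous_on UNIV (\<lambda>w. G (fst w) (snd w))"
    and hF: "\<And>w. (\<lambda>z. F z w) holomorphic_on UNIV" and hG: "\<And>w. (\<lambda>z. G z w) holomorphic_on UNIV"
    and nz: "\<And>z w. norm z < 1 \<Longrightarrow> norm w < 1 \<Longrightarrow> F z w \<noteq> 0"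
    and le: "\<And>z w. norm z < 1 \<Longrightarrow> norm w < 1 \<Longrightarrow> norm (G z w) \<le> norm (F z w)"
    and z0: "norm z0 < 1" "norm w \<le> 1" "F z0 w = G z0 w" and z: "norm z \<le> 1"
  shows "F z w = G z w"
proof -
  \<comment> \<open>The factor on \<open>w\<close> moves it into the open disc, where the domination
    is available; the factor on \<open>G\<close> makes the domination strict.\<close>
  define h where "h = (\<lambda>x. F (snd x) (of_real (fst x) * w) - of_real (fst x) * G (snd x) (of_real (fst x) * w))"
  have cF': "continuous_on S (\<lambda>x. F (snd x) (of_real (fst x) * w))" for S :: "(real \<times> complex) set"
    using continuous_on_compose2[OF cF, of S "\<lambda>x. (snd x, of_real (fst x) * w)"]
    by (simp add: continuous_intros)
  have cG': "continuous_on S (\<lambda>x. G (snd x) (of_real (fst x) * w))" for S :: "(real \<times> complex) set"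
    using continuous_on_compose2[OF cG, of S "\<lambda>x. (snd x, of_real (fst x) * w)"]
    by (simp add: continuous_intros)
  have "h (1, z) = 0"
  proof (rule Hurwitz_homotopy[of h z0])
    show "continuous_on ({0..1} \<times> cball 0 1) h"
      unfolding h_def by (intro continuous_intros cF' cG')
    show "(\<lambda>z. h (t, z)) holomorphic_on ball 0 1" for t
      unfolding h_def fst_conv snd_conv
      by (intro holomorphic_intros holomorphic_on_subset[OF hF] holomorphic_on_subset[OF hG]) auto
    fix t :: real and z :: complex assume t: "0 \<le> t" "t < 1" and z: "norm z < 1"
    have "t * norm w \<le> t * 1" using t z0 by (intro mult_left_mono) auto
    then have tw: "norm (of_real t * w) < 1" using t by (simp add: norm_mult)
    have "norm (of_real t * G z (of_real t * w)) \<le> t * norm (F z (of_real t * w))"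
      using le[OF z tw] t by (simp add: norm_mult mult_left_mono)
    also have "\<dots> < 1 * norm (F z (of_real t * w))"
      using t nz[OF z tw] by (intro mult_strict_right_mono) auto
    finally show "h (t, z) \<noteq> 0" unfolding h_def by auto
  qed (use z0 z in \<open>auto simp: h_def\<close>)
  then show ?thesis by (simp add: h_def)
qed

text \<open>A point of equality is pushed to the 2-torus one variable at a time: equality at an
  interior \<open>z\<close> spreads to the boundary value 1 with \<open>w\<close> fixed, then the
  same happens in \<open>w\<close>.\<close>

lemma no_zero_closed_bidisc:
  assumes nz: "\<And>z w. norm z < 1 \<Longrightarrow> norm w < 1 \<Longrightarrow> poly2 m n c z w \<noteq> 0"
    and le: "\<And>z w. norm z < 1 \<Longrightarrow> norm w < 1 \<Longrightarrow> norm (poly2 m n d z w) \<le> norm (poly2 m n c z w)"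
    and torus: "\<And>z w. norm z = 1 \<Longrightarrow> norm w = 1 \<Longrightarrow> poly2 m n c z w \<noteq> poly2 m n d z w"
    and zw: "norm z \<le> 1" "norm w \<le> 1"
  shows "poly2 m n c z w \<noteq> poly2 m n d z w"
proof
  assume eq: "poly2 m n c z w = poly2 m n d z w"
  have "\<exists>z. norm z = 1 \<and> poly2 m n c z w = poly2 m n d z w"
  proof (cases "norm z < 1")
    case True
    have "poly2 m n c 1 w = poly2 m n d 1 w"
      by (rule zero_propagates[of "poly2 m n c" "poly2 m n d" z])
         (use nz le zw True eq in \<open>auto intro!: continuous_intros holomorphic_intros\<close>)
    then show ?thesis by (intro exI[of _ 1]) auto
  qed (use eq zw in auto)
  then obtain z where z: "norm z = 1" "poly2 m n c z w = poly2 m n d z w" by blast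
  show False
  proof (cases "norm w < 1")
    case True
    have "poly2 m n c z 1 = poly2 m n d z 1"
      by (rule zero_propagates[of "\<lambda>w z. poly2 m n c z w" "\<lambda>w z. poly2 m n d z w" w])
         (use nz le z True in \<open>auto intro!: continuous_intros holomorphic_intros\<close>)
    then show ?thesis using torus[of z 1] z by auto
  qed (use torus z zw in auto)
qed

section \<open>First-order conditions at boundary contact points\<close>

lemma one_minus_in_disc:
  assumes "0 < Re c"
  shows "eventually (\<lambda>s. norm (1 - of_real s * c) < 1) (at_right (0::real))"
proof -
  \<comment> \<open>The squared modulus is \<open>1 - 2 s Re c + s^2 |c|^2\<close>, which is below 1
    for \<open>0 < s < 2 Re c / |c|^2\<close>; half of this range is taken.\<close>
  have "eventually (\<lambda>s. s \<in> {0<..<Re c / (norm c)\<^sup>2}) (at_right (0::real))"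
    using assms by (intro eventually_at_right_real) (auto intro!: divide_pos_pos)
  then show ?thesis
  proof eventually_elim
    case (elim s)
    have "(norm c)\<^sup>2 > 0" using assms by auto
    with elim have "s * (norm c)\<^sup>2 < Re c" by (simp add: less_divide_eq)
    then have "s * (s * (norm c)\<^sup>2) < s * (2 * Re c)" using elim assms by (intro mult_strict_left_mono) auto
    moreover have "(norm (1 - of_real s * c))\<^sup>2 = 1 - s * (2 * Re c) + s * (s * (norm c)\<^sup>2)"
      unfolding cmod_power2 by (simp add: algebra_simps power2_eq_square)
    ultimately have "(norm (1 - of_real s * c))\<^sup>2 < 1\<^sup>2" by simp
    then show ?case by (rule power2_less_imp_less) simp
  qed
qed

text \<open>The function \<open>|f|^2 - |g|^2\<close> is nonnegative on the bidisc and vanishes at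
  the contact point, so its derivative along an entering curve cannot be negative. The inward
  directions are \<open>(- t1 c1, - t2 c2)\<close>, which accounts for the sign.\<close>

lemma contact_derivative_Re:
  fixes f g :: "complex \<times> complex \<Rightarrow> complex"
  assumes f: "(f has_derivative (\<lambda>v. f1 * fst v + f2 * snd v)) (at (t1, t2))"
    and g: "(g has_derivative (\<lambda>v. g1 * fst v + g2 * snd v)) (at (t1, t2))"
    and t: "norm t1 = 1" "norm t2 = 1"
    and le: "\<And>z w. norm z < 1 \<Longrightarrow> norm w < 1 \<Longrightarrow> norm (g (z, w)) \<le> norm (f (z, w))"
    and eq: "f (t1, t2) = g (t1, t2)"
    and c: "0 < Re c1" "0 < Re c2"
  shows "Re (cnj (f (t1, t2)) * (t1 * (f1 - g1) * c1 + t2 * (f2 - g2) * c2)) \<le> 0"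
proof (rule ccontr)
  assume neg: "\<not> ?thesis"
  define \<gamma> where "\<gamma> = (\<lambda>s::real. (t1 * (1 - of_real s * c1), t2 * (1 - of_real s * c2)))"
  have \<gamma>: "(\<gamma> has_derivative (\<lambda>s. (- t1 * (of_real s * c1), - t2 * (of_real s * c2)))) (at 0)"
    unfolding \<gamma>_def by (auto intro!: derivative_eq_intros)
  have \<gamma>0: "\<gamma> 0 = (t1, t2)" by (simp add: \<gamma>_def)
  have df: "((\<lambda>s. f (\<gamma> s)) has_derivative (\<lambda>s. f1 * (- t1 * (of_real s * c1)) + f2 * (- t2 * (of_real s * c2)))) (at 0)"
    using has_derivative_compose[OF \<gamma>, unfolded \<gamma>0, OF f] by simp
  have dg: "((\<lambda>s. g (\<gamma> s)) has_derivative (\<lambda>s. g1 * (- t1 * (of_real s * c1)) + g2 * (- t2 * (of_real s * c2)))) (at 0)"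
    using has_derivative_compose[OF \<gamma>, unfolded \<gamma>0, OF g] by simp
  define D where "D = (\<lambda>s. f (\<gamma> s) \<bullet> f (\<gamma> s) - g (\<gamma> s) \<bullet> g (\<gamma> s))"
  define l where "l = - 2 * Re (cnj (f (t1, t2)) * (t1 * (f1 - g1) * c1 + t2 * (f2 - g2) * c2))"
  have "(D has_derivative (\<lambda>s. l * s)) (at 0)"
    unfolding D_def
    by (rule has_derivative_eq_rhs[OF has_derivative_diff[OF has_derivative_inner[OF df df] has_derivative_inner[OF dg dg]]])
       (auto simp: fun_eq_iff \<gamma>0 eq l_def inner_complex_def algebra_simps)
  then have "DERIV D 0 :> l" by (simp add: has_field_derivative_def)
  moreover have "l < 0" using neg unfolding l_def by linarith
  ultimately have "\<exists>d>0. \<forall>h>0. h < d \<longrightarrow> D 0 > D (0 + h)"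
    by (rule DERIV_neg_dec_right)
  then obtain d where d: "d > 0" "\<And>h. 0 < h \<Longrightarrow> h < d \<Longrightarrow> D h < D 0"
    by auto
  have "eventually (\<lambda>s. norm (1 - of_real s * c1) < 1 \<and> norm (1 - of_real s * c2) < 1 \<and> s \<in> {0<..<d}) (at_right (0::real))"
    using one_minus_in_disc[OF c(1)] one_minus_in_disc[OF c(2)] eventually_at_right_real[OF d(1)]
    by eventually_elim simp
  then obtain s where s: "norm (1 - of_real s * c1) < 1" "norm (1 - of_real s * c2) < 1" "s \<in> {0<..<d}"
    using eventually_happens'[OF trivial_limit_at_right_real] by blast
  have "norm (g (\<gamma> s)) \<le> norm (f (\<gamma> s))"
    unfolding \<gamma>_def using s t by (intro le) (auto simp: norm_mult)
  then have "D s \<ge> 0" unfolding D_def dot_square_norm by (simp add: power_mono)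
  moreover have "D 0 = 0" by (simp add: D_def \<gamma>0 eq)
  ultimately show False using d(2)[of s] s by auto
qed

text \<open>Letting \<open>c2\<close> tend to 0 leaves a condition on \<open>k1\<close> alone over
  the closed right half-plane. The test value 1 gives the sign of the real part; \<open>\<i>\<close>
  and \<open>-\<i>\<close> together kill the imaginary part.\<close>

lemma linear_functional_right_half_plane:
  assumes "\<And>c1 c2. 0 < Re c1 \<Longrightarrow> 0 < Re c2 \<Longrightarrow> Re (k1 * c1 + k2 * c2) \<le> 0"
  shows "Im k1 = 0 \<and> Re k1 \<le> 0"
proof -
  have *: "Re (k1 * c) \<le> 0" if "0 \<le> Re c" for c
  proof (rule field_le_epsilon)
    fix e :: real assume e: "0 < e"
    \<comment> \<open>The summand 1 keeps the denominator positive when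
      \<open>Re (k1 + k2) = 0\<close>.\<close>
    define d where "d = e / (1 + \<bar>Re (k1 + k2)\<bar>)"
    have d: "d > 0" "d * (1 + \<bar>Re (k1 + k2)\<bar>) = e" unfolding d_def using e by (auto intro!: divide_pos_pos)
    have "Re (k1 * (c + of_real d) + k2 * of_real d) \<le> 0"
      using that d(1) by (intro assms) auto
    then have "Re (k1 * c) \<le> d * (- Re (k1 + k2))" by (simp add: algebra_simps)
    also have "\<dots> \<le> d * (1 + \<bar>Re (k1 + k2)\<bar>)" using d by (intro mult_left_mono) auto
    finally show "Re (k1 * c) \<le> 0 + e" using d by simp
  qed
  show ?thesis using *[of 1] *[of \<i>] *[of "-\<i>"] by auto
qed

text \<open>Since \<open>c1\<close> and \<open>c2\<close> vary independently over the right
  half-plane, the first-order inequality splits into one condition per variable, as in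
  Julia-Caratheodory theory.\<close>

lemma contact_derivative:
  fixes f g :: "complex \<times> complex \<Rightarrow> complex"
  assumes f: "(f has_derivative (\<lambda>v. f1 * fst v + f2 * snd v)) (at (t1, t2))"
    and g: "(g has_derivative (\<lambda>v. g1 * fst v + g2 * snd v)) (at (t1, t2))"
    and t: "norm t1 = 1" "norm t2 = 1"
    and le: "\<And>z w. norm z < 1 \<Longrightarrow> norm w < 1 \<Longrightarrow> norm (g (z, w)) \<le> norm (f (z, w))"
    and eq: "f (t1, t2) = g (t1, t2)"
  shows "\<exists>r\<ge>0. cnj (f (t1, t2)) * (t1 * (f1 - g1)) = - of_real r"
    and "\<exists>r\<ge>0. cnj (f (t1, t2)) * (t2 * (f2 - g2)) = - of_real r"
proof -
  let ?k1 = "cnj (f (t1, t2)) * (t1 * (f1 - g1))" and ?k2 = "cnj (f (t1, t2)) * (t2 * (f2 - g2))"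
  have *: "Re (?k1 * c1 + ?k2 * c2) \<le> 0" if "0 < Re c1" "0 < Re c2" for c1 c2
    using contact_derivative_Re[OF f g t le eq that] by (simp add: algebra_simps)
  have "Im ?k1 = 0 \<and> Re ?k1 \<le> 0"
    by (rule linear_functional_right_half_plane[of _ ?k2]) (rule *)
  then show "\<exists>r\<ge>0. ?k1 = - of_real r"
    by (intro exI[of _ "- Re ?k1"]) (auto simp: complex_eq_iff)
  have "Im ?k2 = 0 \<and> Re ?k2 \<le> 0"
    by (rule linear_functional_right_half_plane[of _ ?k1]) (use * in \<open>simp add: add.commute\<close>)
  then show "\<exists>r\<ge>0. ?k2 = - of_real r"
    by (intro exI[of _ "- Re ?k2"]) (auto simp: complex_eq_iff)
qed

text \<open>The identity \<open>q~ = z1^m z2^n cnj q\<close> holds on the 2-torus and is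
  differentiated along its curves \<open>(t1 e^(ixs), t2 e^(iys))\<close>. The minus sign arises
  from conjugating \<open>\<i>\<close>.\<close>

lemma refl2_derivative:
  assumes q: "((\<lambda>w. poly2 m n c (fst w) (snd w)) has_derivative (\<lambda>v. k1 * fst v + k2 * snd v)) (at (t1, t2))"
    and qt: "((\<lambda>w. poly2 m n (refl2 m n c) (fst w) (snd w)) has_derivative (\<lambda>v. l1 * fst v + l2 * snd v)) (at (t1, t2))"
    and t: "norm t1 = 1" "norm t2 = 1"
    and z: "poly2 m n c t1 t2 = 0"
  shows "t1 * l1 = - (t1 ^ m * t2 ^ n * cnj (t1 * k1))"
    and "t2 * l2 = - (t1 ^ m * t2 ^ n * cnj (t2 * k2))"
proof -
  have *: "t1 * l1 * of_real x + t2 * l2 * of_real y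
      = - (t1 ^ m * t2 ^ n * (cnj (t1 * k1) * of_real x + cnj (t2 * k2) * of_real y))" for x y :: real
  proof -
    define e where "e = (\<lambda>x s :: real. exp (\<i> * of_real (x * s)))"
    have e: "(e x has_derivative (\<lambda>s. \<i> * of_real (x * s))) (at 0)" for x
    proof -
      have "((\<lambda>s. \<i> * of_real (x * s)) has_derivative (\<lambda>s. \<i> * of_real (x * s))) (at 0)"
        by (auto intro!: derivative_eq_intros)
      from has_derivative_compose[OF this DERIV_exp[unfolded has_field_derivative_def]] show ?thesis unfolding e_def by simp
    qed
    have e0: "e x 0 = 1" and ne: "norm (e x s) = 1" for x s by (auto simp: e_def)
    define \<gamma> where "\<gamma> = (\<lambda>s::real. (t1 * e x s, t2 * e y s))"
    have \<gamma>: "(\<gamma> has_derivative (\<lambda>s. (t1 * (\<i> * of_real (x * s)), t2 * (\<i> * of_real (y * s))))) (at 0)"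
      unfolding \<gamma>_def by (intro derivative_intros e)
    have \<gamma>0: "\<gamma> 0 = (t1, t2)" by (simp add: \<gamma>_def e0)
    \<comment> \<open>The derivative of this monomial factor drops out, being multiplied by the
      conjugate of the value of \<open>q\<close> at the point, which is 0.\<close>
    define A where "A = (\<lambda>s. (t1 * e x s) ^ m * (t2 * e y s) ^ n)"
    have "A differentiable at 0"
      unfolding A_def using e[THEN differentiableI] by (intro derivative_intros) auto
    then obtain A' where A': "(A has_derivative A') (at 0)" by (auto simp: differentiable_def)
    have dq: "((\<lambda>s. poly2 m n c (fst (\<gamma> s)) (snd (\<gamma> s))) has_derivative
        (\<lambda>s. k1 * (t1 * (\<i> * of_real (x * s))) + k2 * (t2 * (\<i> * of_real (y * s))))) (at 0)"
      using has_derivative_compose[OF \<gamma>, unfolded \<gamma>0, OF q] by simp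
    have dqt: "((\<lambda>s. poly2 m n (refl2 m n c) (fst (\<gamma> s)) (snd (\<gamma> s))) has_derivative
        (\<lambda>s. l1 * (t1 * (\<i> * of_real (x * s))) + l2 * (t2 * (\<i> * of_real (y * s))))) (at 0)"
      using has_derivative_compose[OF \<gamma>, unfolded \<gamma>0, OF qt] by simp
    have "(\<lambda>s. poly2 m n (refl2 m n c) (fst (\<gamma> s)) (snd (\<gamma> s)))
        = (\<lambda>s. A s * cnj (poly2 m n c (fst (\<gamma> s)) (snd (\<gamma> s))))"
      unfolding \<gamma>_def A_def by (intro ext) (simp add: poly2_refl2_torus norm_mult ne t)
    from has_derivative_unique[OF dqt[unfolded this] has_derivative_mult[OF A' has_derivative_cnj[OF dq]]]
    have "l1 * (t1 * (\<i> * of_real x)) + l2 * (t2 * (\<i> * of_real y))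
      = A 0 * cnj (k1 * (t1 * (\<i> * of_real x)) + k2 * (t2 * (\<i> * of_real y)))"
      by (auto simp: \<gamma>0 z dest: fun_cong[of _ _ 1])
    then have "\<i> * (t1 * l1 * of_real x + t2 * l2 * of_real y)
      = \<i> * (- (t1 ^ m * t2 ^ n * (cnj (t1 * k1) * of_real x + cnj (t2 * k2) * of_real y)))"
      by (simp add: A_def e0 algebra_simps)
    then show ?thesis by (rule mult_left_cancel[THEN iffD1, rotated]) simp
  qed
  show "t1 * l1 = - (t1 ^ m * t2 ^ n * cnj (t1 * k1))" using *[of 1 0] by simp
  show "t2 * l2 = - (t1 ^ m * t2 ^ n * cnj (t2 * k2))" using *[of 0 1] by simp
qed

section \<open>Gradients in three variables and nontangential limits\<close>

lemma pencil_has_derivative: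
  assumes f: "((\<lambda>w. f (fst w) (snd w)) has_derivative (\<lambda>v. f1 * fst v + f2 * snd v)) (at (t1, t2))"
    and g: "((\<lambda>w. g (fst w) (snd w)) has_derivative (\<lambda>v. g1 * fst v + g2 * snd v)) (at (t1, t2))"
  shows "((\<lambda>z :: c3. f (fst z) (fst (snd z)) + snd (snd z) * g (fst z) (fst (snd z))) has_derivative
     (\<lambda>v. (f1 + t3 * g1) * fst v + (f2 + t3 * g2) * fst (snd v) + g t1 t2 * snd (snd v))) (at (t1, t2, t3))"
proof -
  have \<pi>: "((\<lambda>z :: c3. (fst z, fst (snd z))) has_derivative (\<lambda>v. (fst v, fst (snd v)))) (at (t1, t2, t3))"
    and \<pi>3: "((\<lambda>z :: c3. snd (snd z)) has_derivative (\<lambda>v. snd (snd v))) (at (t1, t2, t3))"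
    by (auto intro!: derivative_eq_intros)
  have df: "((\<lambda>z :: c3. f (fst z) (fst (snd z))) has_derivative (\<lambda>v. f1 * fst v + f2 * fst (snd v))) (at (t1, t2, t3))"
    using has_derivative_compose[OF \<pi>, unfolded fst_conv snd_conv, OF f] by simp
  have dg: "((\<lambda>z :: c3. g (fst z) (fst (snd z))) has_derivative (\<lambda>v. g1 * fst v + g2 * fst (snd v))) (at (t1, t2, t3))"
    using has_derivative_compose[OF \<pi>, unfolded fst_conv snd_conv, OF g] by simp
  show ?thesis
    by (rule has_derivative_eq_rhs[OF has_derivative_add[OF df has_derivative_mult[OF \<pi>3 dg]]])
       (auto simp: algebra_simps)
qed

lemma pP_has_derivative_ex:
  "\<exists>\<alpha>1 \<alpha>2. (pP m n a b has_derivative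
     (\<lambda>v. \<alpha>1 * fst v + \<alpha>2 * fst (snd v) + poly2 m n b t1 t2 * snd (snd v))) (at (t1, t2, t3))"
proof -
  obtain a1 a2 where "((\<lambda>w. poly2 m n a (fst w) (snd w)) has_derivative (\<lambda>v. a1 * fst v + a2 * snd v)) (at (t1, t2))"
    using poly2_has_derivative_ex by blast
  moreover obtain b1 b2 where "((\<lambda>w. poly2 m n b (fst w) (snd w)) has_derivative (\<lambda>v. b1 * fst v + b2 * snd v)) (at (t1, t2))"
    using poly2_has_derivative_ex by blast
  ultimately show ?thesis
    unfolding pP_def by (blast intro: pencil_has_derivative)
qed

text \<open>As \<open>lam * cnj lam = 1\<close>, \<open>\<lambda> q~ = p1~ - \<lambda> p2\<close>;
  collecting powers of \<open>z3\<close> gives the form. Where \<open>q~\<close> is nonzero, the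
  level set is thus the graph \<open>z3 = \<Psi>\<close>.\<close>

lemma level_set_pencil:
  assumes "norm lam = 1"
  shows "lam * pP m n a b z - pPt m n a b z
    = poly2 m n (qcoef m n a b lam) (fst z) (fst (snd z))
    + snd (snd z) * (- lam * poly2 m n (refl2 m n (qcoef m n a b lam)) (fst z) (fst (snd z)))"
proof -
  have "lam * cnj lam = 1" using assms complex_norm_square[of lam] by simp
  then have "lam * (cnj lam * x) = x" for x by (simp flip: mult.assoc)
  then show ?thesis
    unfolding pP_def pPt_def poly2_qcoef poly2_refl2_qcoef by (simp add: algebra_simps)
qed

text \<open>The approach is along \<open>(t1 (1 - s), t2 (1 - s), t3 (1 - k s))\<close>; since \<open>p = O(s)\<close> there, \<open>\<lambda> p - p~ = o(s)\<close>.\<close>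

lemma nt_limit_ray:
  assumes zf: "\<And>z. z \<in> polydisc3 \<Longrightarrow> p z \<noteq> 0"
    and p: "(p has_derivative (\<lambda>v. \<alpha>1 * fst v + \<alpha>2 * fst (snd v) + \<alpha>3 * snd (snd v))) (at (t1, t2, t3))"
    and N: "((\<lambda>z. lam * p z - pt z) has_derivative
          (\<lambda>v. \<nu>1 * fst v + \<nu>2 * fst (snd v) + \<nu>3 * snd (snd v))) (at (t1, t2, t3))"
    and t: "norm t1 = 1" "norm t2 = 1" "norm t3 = 1"
    and p0: "p (t1, t2, t3) = 0"
    and lim: "has_nt_limit (\<lambda>z. pt z / p z) (t1, t2, t3) lam"
    and k: "k \<in> {1, 2}"
  shows "\<nu>1 * t1 + \<nu>2 * t2 + of_real k * \<nu>3 * t3 = 0"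
proof -
  let ?\<tau> = "(t1, t2, t3)" and ?N = "\<lambda>z. lam * p z - pt z"
  \<comment> \<open>The parameter is complex so that a complex derivative at 0 exists; limits are
    then taken along positive real \<open>s\<close>.\<close>
  define \<gamma> where "\<gamma> = (\<lambda>s::complex. (t1 * (1 - s), t2 * (1 - s), t3 * (1 - of_real k * s)))"
  have \<gamma>: "(\<gamma> has_derivative (\<lambda>s. (- (t1 * s), - (t2 * s), - (t3 * (of_real k * s))))) (at 0)"
    unfolding \<gamma>_def by (auto intro!: derivative_eq_intros)
  have \<gamma>0: "\<gamma> 0 = ?\<tau>" by (simp add: \<gamma>_def)
  have quot: "((\<lambda>s. (f (\<gamma> (of_real s)) - f ?\<tau>) / of_real s) \<longlongrightarrow> - (d1 * t1 + d2 * t2 + of_real k * d3 * t3)) (at_right (0::real))"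
    if f: "(f has_derivative (\<lambda>v. d1 * fst v + d2 * fst (snd v) + d3 * snd (snd v))) (at ?\<tau>)"
    for f :: "c3 \<Rightarrow> complex" and d1 d2 d3
  proof -
    have "((\<lambda>s. f (\<gamma> s)) has_field_derivative - (d1 * t1 + d2 * t2 + of_real k * d3 * t3)) (at 0)"
      unfolding has_field_derivative_def
      by (rule has_derivative_eq_rhs[OF has_derivative_compose[OF \<gamma>, unfolded \<gamma>0, OF f]])
         (auto simp: algebra_simps)
    then have "((\<lambda>s. (f (\<gamma> s) - f ?\<tau>) / s) \<longlongrightarrow> - (d1 * t1 + d2 * t2 + of_real k * d3 * t3)) (at 0)"
      by (simp add: DERIV_def \<gamma>0)
    moreover have "filterlim (of_real :: real \<Rightarrow> complex) (at 0) (at_right 0)"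
      by (auto simp: filterlim_at eventually_at intro!: tendsto_eq_intros exI[of _ 1])
    ultimately show ?thesis by (rule filterlim_compose)
  qed
  have ev: "eventually (\<lambda>s. s \<in> {0<..<1/2}) (at_right (0::real))"
    by (rule eventually_at_right_real) simp
  \<comment> \<open>In the maximum norm the point has norm \<open>1 - s\<close> and distance
    \<open>k * s\<close> from the limit point, so aperture 2 serves both \<open>k\<close>; the bound
    1/2 keeps \<open>1 - 2 s\<close> positive.\<close>
  have reg: "\<gamma> (of_real s) \<in> nt_region ?\<tau> 2" "\<gamma> (of_real s) \<noteq> ?\<tau>" if s: "s \<in> {0<..<1/2}" for s
  proof -
    have n1: "norm (1 - of_real s :: complex) = 1 - s"
      using s norm_of_real[of "1 - s", where ?'a = complex] by simp
    have n2: "norm (1 - of_real k * of_real s :: complex) = 1 - k * s"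
      using s k norm_of_real[of "1 - k * s", where ?'a = complex] by auto
    have d: "\<gamma> (of_real s) - ?\<tau> = (- (t1 * of_real s), - (t2 * of_real s), - (t3 * (of_real k * of_real s)))"
      by (simp add: \<gamma>_def algebra_simps)
    have "norm (fst (\<gamma> (of_real s))) = 1 - s" "norm (fst (snd (\<gamma> (of_real s)))) = 1 - s"
        "norm (snd (snd (\<gamma> (of_real s)))) = 1 - k * s"
      unfolding \<gamma>_def by (simp_all add: norm_mult t n1 n2)
    moreover have "maxnorm3 (\<gamma> (of_real s) - ?\<tau>) = k * s"
      unfolding maxnorm3_def d using s k by (auto simp: norm_mult t)
    ultimately show "\<gamma> (of_real s) \<in> nt_region ?\<tau> 2"
      unfolding nt_region_def polydisc3_def using s k by (auto simp: maxnorm3_def)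
    show "\<gamma> (of_real s) \<noteq> ?\<tau>" using d s t(1) by (auto simp: zero_prod_def)
  qed
  have \<gamma>l: "((\<lambda>s. \<gamma> (of_real s)) \<longlongrightarrow> ?\<tau>) (at_right (0::real))"
    unfolding \<gamma>_def by (auto intro!: tendsto_eq_intros)
  have "filterlim (\<lambda>s. \<gamma> (of_real s)) (at ?\<tau> within nt_region ?\<tau> 2) (at_right (0::real))"
    unfolding filterlim_at using \<gamma>l eventually_mono[OF ev] reg by auto
  with lim have S: "((\<lambda>s. pt (\<gamma> (of_real s)) / p (\<gamma> (of_real s))) \<longlongrightarrow> lam) (at_right (0::real))"
    unfolding has_nt_limit_def by (auto intro: filterlim_compose dest: spec[of _ 2])
  have fact: "eventually (\<lambda>s. (lam - pt (\<gamma> (of_real s)) / p (\<gamma> (of_real s))) * p (\<gamma> (of_real s)) = ?N (\<gamma> (of_real s))) (at_right (0::real))"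
    using ev
  proof eventually_elim
    case (elim s)
    then have "p (\<gamma> (of_real s)) \<noteq> 0" using reg(1)[of s] zf unfolding nt_region_def by auto
    then show ?case by (simp add: field_simps)
  qed
  have pl: "((\<lambda>s. p (\<gamma> (of_real s))) \<longlongrightarrow> p ?\<tau>) (at_right (0::real))"
    by (rule isCont_tendsto_compose[OF has_derivative_continuous[OF p] \<gamma>l])
  have Nl: "((\<lambda>s. ?N (\<gamma> (of_real s))) \<longlongrightarrow> ?N ?\<tau>) (at_right (0::real))"
    by (rule isCont_tendsto_compose[OF has_derivative_continuous[OF N] \<gamma>l])
  \<comment> \<open>Writing \<open>?N\<close> as \<open>(lam - pt / p) * p\<close> shows that it
    vanishes at the point; with \<open>p0\<close> this makes \<open>pt\<close> vanish there
    too.\<close>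
  have "((\<lambda>s. ?N (\<gamma> (of_real s))) \<longlongrightarrow> (lam - lam) * p ?\<tau>) (at_right (0::real))"
    by (rule Lim_transform_eventually[OF _ fact]) (intro tendsto_intros S pl)
  from tendsto_unique[OF _ Nl this] have N0: "?N ?\<tau> = 0" by simp
  then have pt0: "pt ?\<tau> = 0" using p0 by simp
  have "((\<lambda>s. (lam - pt (\<gamma> (of_real s)) / p (\<gamma> (of_real s))) * ((p (\<gamma> (of_real s)) - p ?\<tau>) / of_real s))
      \<longlongrightarrow> (lam - lam) * - (\<alpha>1 * t1 + \<alpha>2 * t2 + of_real k * \<alpha>3 * t3)) (at_right (0::real))"
    by (intro tendsto_mult tendsto_diff tendsto_const S quot[OF p])
  moreover have "eventually (\<lambda>s. (lam - pt (\<gamma> (of_real s)) / p (\<gamma> (of_real s))) * ((p (\<gamma> (of_real s)) - p ?\<tau>) / of_real s)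
      = (?N (\<gamma> (of_real s)) - ?N ?\<tau>) / of_real s) (at_right (0::real))"
    using fact by eventually_elim (simp only: pt0 p0 mult_zero_right diff_zero times_divide_eq_right)
  ultimately have "((\<lambda>s. (?N (\<gamma> (of_real s)) - ?N ?\<tau>) / of_real s)
      \<longlongrightarrow> (lam - lam) * - (\<alpha>1 * t1 + \<alpha>2 * t2 + of_real k * \<alpha>3 * t3)) (at_right (0::real))"
    by (rule Lim_transform_eventually)
  from tendsto_unique[OF _ quot[OF N] this]
  have "- (\<nu>1 * t1 + \<nu>2 * t2 + of_real k * \<nu>3 * t3) = 0" by simp
  then show "\<nu>1 * t1 + \<nu>2 * t2 + of_real k * \<nu>3 * t3 = 0" by (metis neg_equal_0_iff_equal)
qed

text \<open>Links the product norm of the derivative estimates to the maximum norm of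
  \<open>nt_region\<close>.\<close>

lemma norm_le_maxnorm3: "norm v \<le> 3 * maxnorm3 v"
proof -
  have "norm v \<le> norm (fst v) + (norm (fst (snd v)) + norm (snd (snd v)))"
    using norm_triangle_ineq[of "(fst v, 0)" "(0, snd v)"]
      norm_triangle_ineq[of "(fst (snd v), 0)" "(0, snd (snd v))"]
    by (simp add: norm_Pair)
  then show ?thesis by (simp add: maxnorm3_def)
qed

text \<open>Each difference is \<open>z - t = - t c\<close> with \<open>Re c \<ge> 1 - |z|\<close>.
  Multiplication by \<open>- cnj (t3 * \<alpha>3)\<close> gives the three \<open>c\<close>
  nonnegative real coefficients, so nothing cancels in the real part and the third term alone yields
  the bound.\<close>

lemma sum_nonneg_multiples_lower_bound:
  fixes \<alpha>1 \<alpha>2 \<alpha>3 :: complex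
  assumes t: "norm t1 = 1" "norm t2 = 1" "norm t3 = 1"
    and r: "0 \<le> r1" "0 \<le> r2"
      "cnj (t3 * \<alpha>3) * (t1 * \<alpha>1) = of_real r1" "cnj (t3 * \<alpha>3) * (t2 * \<alpha>2) = of_real r2"
    and z: "norm z1 \<le> 1" "norm z2 \<le> 1" "norm z3 \<le> 1"
  shows "norm \<alpha>3 * (1 - norm z3) \<le> norm (\<alpha>1 * (z1 - t1) + \<alpha>2 * (z2 - t2) + \<alpha>3 * (z3 - t3))"
proof (cases "\<alpha>3 = 0")
  case False
  let ?L = "\<alpha>1 * (z1 - t1) + \<alpha>2 * (z2 - t2) + \<alpha>3 * (z3 - t3)"
  define c where "c = (\<lambda>t z :: complex. 1 - cnj t * z)"
  have tc: "z - t = - (t * c t z)" if "norm t = 1" for t z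
  proof -
    have "t * cnj t = 1" using that complex_norm_square[of t] by simp
    moreover have "t * c t z = t - (t * cnj t) * z" by (simp add: c_def algebra_simps)
    ultimately show ?thesis by simp
  qed
  have Rec: "1 - norm z \<le> Re (c t z)" if "norm t = 1" for t z
    using complex_Re_le_cmod[of "cnj t * z"] that by (simp add: c_def norm_mult)
  have "cnj (t3 * \<alpha>3) * (t3 * \<alpha>3) = of_real ((norm \<alpha>3)\<^sup>2)"
    using complex_norm_square[of "t3 * \<alpha>3"] t by (simp add: norm_mult mult.commute)
  have "- (cnj (t3 * \<alpha>3) * ?L) = cnj (t3 * \<alpha>3) * (t1 * \<alpha>1) * c t1 z1 + cnj (t3 * \<alpha>3) * (t2 * \<alpha>2) * c t2 z2
      + cnj (t3 * \<alpha>3) * (t3 * \<alpha>3) * c t3 z3"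
    unfolding tc[OF t(1)] tc[OF t(2)] tc[OF t(3)] by (simp add: algebra_simps)
  also have "\<dots> = of_real r1 * c t1 z1 + of_real r2 * c t2 z2 + of_real ((norm \<alpha>3)\<^sup>2) * c t3 z3"
    by (simp only: r(3,4) \<open>cnj (t3 * \<alpha>3) * (t3 * \<alpha>3) = _\<close>)
  finally have "Re (- (cnj (t3 * \<alpha>3) * ?L)) = r1 * Re (c t1 z1) + r2 * Re (c t2 z2) + (norm \<alpha>3)\<^sup>2 * Re (c t3 z3)"
    by (simp only: plus_complex.sel Re_complex_of_real Im_complex_of_real times_complex.sel)
  moreover have "0 \<le> r1 * Re (c t1 z1)" "0 \<le> r2 * Re (c t2 z2)"
    using r Rec[OF t(1), of z1] Rec[OF t(2), of z2] z by auto
  moreover have "(norm \<alpha>3)\<^sup>2 * (1 - norm z3) \<le> (norm \<alpha>3)\<^sup>2 * Re (c t3 z3)"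
    using Rec[OF t(3)] by (intro mult_left_mono) auto
  ultimately have "(norm \<alpha>3)\<^sup>2 * (1 - norm z3) \<le> Re (- (cnj (t3 * \<alpha>3) * ?L))" by linarith
  also have "\<dots> \<le> norm (- (cnj (t3 * \<alpha>3) * ?L))" by (rule complex_Re_le_cmod)
  also have "\<dots> = norm \<alpha>3 * norm ?L" using t by (simp add: norm_mult)
  finally have "norm \<alpha>3 * (norm \<alpha>3 * (1 - norm z3)) \<le> norm \<alpha>3 * norm ?L"
    by (simp add: power2_eq_square)
  then show ?thesis by (rule mult_left_le_imp_le) (simp add: False)
qed simp

lemma has_derivative_at_zero_bound:
  assumes "(f has_derivative f') (at x)" "f x = 0" "e > 0"
  shows "\<exists>d>0. \<forall>y. norm (y - x) < d \<longrightarrow> norm (f y - f' (y - x)) \<le> e * norm (y - x)"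
  using assms unfolding has_derivative_at_alt by (metis diff_zero)

text \<open>In \<open>lam - pt / p = (lam * p - pt) / p\<close> the numerator is of smaller order
  than the distance to the point. The linear part of \<open>p\<close> is at least
  \<open>|\<alpha>3| (1 - |z3|)\<close>, which in a nontangential region dominates a multiple of
  that distance.\<close>

lemma has_nt_limit_level:
  assumes zf: "\<And>z. z \<in> polydisc3 \<Longrightarrow> p z \<noteq> 0"
    and p: "(p has_derivative (\<lambda>v. \<alpha>1 * fst v + \<alpha>2 * fst (snd v) + \<alpha>3 * snd (snd v))) (at (t1, t2, t3))"
    and N: "((\<lambda>z. lam * p z - pt z) has_derivative (\<lambda>v. 0)) (at (t1, t2, t3))"
    and p0: "p (t1, t2, t3) = 0" "pt (t1, t2, t3) = 0"
    and t: "norm t1 = 1" "norm t2 = 1" "norm t3 = 1"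
    and \<alpha>: "\<alpha>3 \<noteq> 0"
    and r: "0 \<le> r1" "0 \<le> r2"
      "cnj (t3 * \<alpha>3) * (t1 * \<alpha>1) = of_real r1" "cnj (t3 * \<alpha>3) * (t2 * \<alpha>2) = of_real r2"
  shows "has_nt_limit (\<lambda>z. pt z / p z) (t1, t2, t3) lam"
  unfolding has_nt_limit_def
proof (intro allI impI tendstoI)
  fix C e :: real assume C: "C > 0" and e: "e > 0"
  let ?\<tau> = "(t1, t2, t3)"
  define A where "A = norm \<alpha>3"
  have A: "A > 0" using \<alpha> by (simp add: A_def)
  \<comment> \<open>Since the norm is at most \<open>3 * M\<close>, the first tolerance costs half
    of the main term \<open>A * M / C\<close>; the second bounds the numerator by
    \<open>e / 2\<close> times the remaining half.\<close>
  have e1: "A / (6 * C) > 0" "e * A / (12 * C) > 0" using A C e by auto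
  have N0: "lam * p ?\<tau> - pt ?\<tau> = 0" using p0 by simp
  obtain d1 where d1: "d1 > 0" "\<And>y. norm (y - ?\<tau>) < d1 \<Longrightarrow>
     norm (p y - (\<alpha>1 * fst (y - ?\<tau>) + \<alpha>2 * fst (snd (y - ?\<tau>)) + \<alpha>3 * snd (snd (y - ?\<tau>)))) \<le> A / (6 * C) * norm (y - ?\<tau>)"
    using has_derivative_at_zero_bound[OF p p0(1), of "A / (6 * C)"] e1 by blast
  obtain d2 where d2: "d2 > 0" "\<And>y. norm (y - ?\<tau>) < d2 \<Longrightarrow>
     norm (lam * p y - pt y) \<le> e * A / (12 * C) * norm (y - ?\<tau>)"
    using has_derivative_at_zero_bound[OF N N0, of "e * A / (12 * C)"] e1 by (metis diff_zero)
  show "\<forall>\<^sub>F z in at ?\<tau> within nt_region ?\<tau> C. dist (pt z / p z) lam < e"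
    unfolding eventually_at
  proof (intro exI[of _ "min d1 d2"] conjI ballI impI)
    fix z assume z: "z \<in> nt_region ?\<tau> C" and "z \<noteq> ?\<tau> \<and> dist z ?\<tau> < min d1 d2"
    then have dz: "norm (z - ?\<tau>) < d1" "norm (z - ?\<tau>) < d2" by (auto simp: dist_norm)
    obtain z1 z2 z3 where zz: "z = (z1, z2, z3)" by (cases z)
    define M where "M = maxnorm3 (z - ?\<tau>)"
    have nM: "norm (z - ?\<tau>) \<le> 3 * M" unfolding M_def by (rule norm_le_maxnorm3)
    have pz: "p z \<noteq> 0" and zb: "norm z1 < 1" "norm z2 < 1" "norm z3 < 1"
      and MC: "M \<le> C * (1 - maxnorm3 z)"
      using z zf unfolding nt_region_def polydisc3_def zz M_def by auto
    have "M \<le> C * (1 - norm z3)"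
      using C by (intro order_trans[OF MC] mult_left_mono) (auto simp: maxnorm3_def zz)
    then have "A * (M / C) \<le> A * (1 - norm z3)"
      using A C by (intro mult_left_mono) (auto simp: divide_le_eq mult.commute)
    also have "\<dots> \<le> norm (\<alpha>1 * (z1 - t1) + \<alpha>2 * (z2 - t2) + \<alpha>3 * (z3 - t3))"
      unfolding A_def using zb
      by (intro sum_nonneg_multiples_lower_bound[OF t r]) auto
    also have "\<dots> \<le> norm (p z) + A / (6 * C) * norm (z - ?\<tau>)"
      using d1(2)[OF dz(1)] norm_triangle_sub[of "\<alpha>1 * (z1 - t1) + \<alpha>2 * (z2 - t2) + \<alpha>3 * (z3 - t3)" "p z"]
      by (simp add: zz norm_minus_commute)
    also have "\<dots> \<le> norm (p z) + A / (6 * C) * (3 * M)"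
      using A C nM by (intro add_left_mono mult_left_mono) auto
    finally have lower: "A * M / (2 * C) \<le> norm (p z)"
      using C by (simp add: field_simps)
    have "norm (lam * p z - pt z) \<le> e * A / (12 * C) * (3 * M)"
      using A C e by (intro order_trans[OF d2(2)[OF dz(2)]] mult_left_mono nM) auto
    also have "\<dots> = e / 2 * (A * M / (2 * C))" using C by (simp add: field_simps)
    also have "\<dots> \<le> e / 2 * norm (p z)" using e lower by (intro mult_left_mono) auto
    also have "\<dots> < e * norm (p z)" using e pz by (intro mult_strict_right_mono) auto
    finally have "norm (lam * p z - pt z) / norm (p z) < e" using pz by (simp add: divide_less_eq)
    moreover have "pt z / p z - lam = - ((lam * p z - pt z) / p z)" using pz by (simp add: field_simps)
    ultimately show "dist (pt z / p z) lam < e" by (simp add: dist_norm norm_divide)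
  qed (use d1 d2 in auto)
qed

section \<open>Boundary zeros of \<open>p\<close> and zeros of \<open>q\<close> on the
  2-torus\<close>

context \<comment> \<open>\<open>p1\<close> has coefficients \<open>a\<close>, \<open>p2\<close> has coefficients \<open>b\<close>\<close>
  fixes m n :: nat and a b :: "nat \<Rightarrow> nat \<Rightarrow> complex"
  assumes zero_free: "\<And>z. z \<in> polydisc3 \<Longrightarrow> pP m n a b z \<noteq> 0"
begin

lemma p1_nonzero:
  assumes "norm z1 < 1" "norm z2 < 1"
  shows "poly2 m n a z1 z2 \<noteq> 0"
  using zero_free[of "(z1, z2, 0)"] assms by (auto simp: polydisc3_def pP_def)

text \<open>Otherwise \<open>z3 = - p1 / p2\<close> would lie in the disc and give a zero of
  \<open>p\<close>.\<close>

lemma p2_le_p1: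
  assumes "norm z1 < 1" "norm z2 < 1"
  shows "norm (poly2 m n b z1 z2) \<le> norm (poly2 m n a z1 z2)"
proof (rule ccontr)
  assume gt: "\<not> ?thesis"
  then have nz: "poly2 m n b z1 z2 \<noteq> 0" by auto
  let ?z3 = "- (poly2 m n a z1 z2 / poly2 m n b z1 z2)"
  have "(z1, z2, ?z3) \<in> polydisc3"
    using gt nz assms by (auto simp: polydisc3_def norm_divide divide_less_eq)
  then have "pP m n a b (z1, z2, ?z3) \<noteq> 0" by (rule zero_free)
  then show False using nz by (simp add: pP_def)
qed

lemma p2_refl_le_p1:
  assumes "norm z1 < 1" "norm z2 < 1"
  shows "norm (poly2 m n (refl2 m n b) z1 z2) \<le> norm (poly2 m n a z1 z2)"
  using refl2_dominated[of m n a b] p1_nonzero p2_le_p1 assms by blast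

text \<open>The converse direction, needed for (B): a zero of \<open>q\<close> lifts to a boundary
  zero of \<open>p\<close>, with \<open>t3 = - p1 / p2\<close> as the only candidate. Two contact
  inequalities supply the gradient conditions of \<open>has_nt_limit_level\<close>.\<close>

lemma singular_point_nt_limit:
  assumes fin: "finite {\<tau> \<in> torus3. pP m n a b \<tau> = 0}"
    and lam: "norm lam = 1" and t: "norm t1 = 1" "norm t2 = 1"
    and q0: "poly2 m n (qcoef m n a b lam) t1 t2 = 0"
  obtains t3 where "norm t3 = 1" "pP m n a b (t1, t2, t3) = 0"
    "has_nt_limit (\<lambda>z. pPt m n a b z / pP m n a b z) (t1, t2, t3) lam"
proof -
  let ?q = "qcoef m n a b lam"
  define A B At Bt where "A = poly2 m n a t1 t2" and "B = poly2 m n b t1 t2"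
    and "At = poly2 m n (refl2 m n a) t1 t2" and "Bt = poly2 m n (refl2 m n b) t1 t2"
  note AB = A_def B_def At_def Bt_def
  have ll: "lam * cnj lam = 1" using lam complex_norm_square[of lam] by simp
  have qt0: "poly2 m n (refl2 m n ?q) t1 t2 = 0"
    using norm_poly2_refl2_torus[OF t, of m n ?q] q0 by simp
  have lA: "lam * A = Bt" using q0 by (simp add: poly2_qcoef AB)
  have lB: "cnj lam * At = B" using qt0 by (simp add: poly2_refl2_qcoef AB)
  have At: "At = lam * B" using ll by (simp flip: lB mult.assoc)
  have nA: "norm B = norm A"
    using norm_poly2_refl2_torus[OF t, of m n b, folded AB] lam by (simp add: norm_mult flip: lA)
  have pz: "pP m n a b (t1, t2, z) = A + z * B" for z by (simp add: pP_def AB)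
  \<comment> \<open>If \<open>p1\<close> vanished here, so would \<open>p2\<close>, and
    \<open>p\<close> would be zero on the whole circle above \<open>(t1, t2)\<close>, against
    finiteness.\<close>
  have A0: "A \<noteq> 0"
  proof
    assume "A = 0"
    then have "B = 0" using nA by simp
    have "(\<lambda>z. (t1, t2, z)) ` sphere 0 1 \<subseteq> {\<tau> \<in> torus3. pP m n a b \<tau> = 0}"
      using t \<open>A = 0\<close> \<open>B = 0\<close> by (auto simp: torus3_def pz)
    then have "finite ((\<lambda>z. (t1, t2, z)) ` sphere (0::complex) 1)"
      using fin by (rule finite_subset)
    then have "finite (sphere (0::complex) 1)"
      by (rule finite_imageD) (auto simp: inj_on_def)
    moreover have "connected (sphere (0::complex) 1)" by (rule connected_sphere) simp
    ultimately have "sphere (0::complex) 1 = {} \<or> (\<exists>z. sphere (0::complex) 1 = {z})"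
      by (rule connected_finite_iff_sing[THEN iffD1, rotated])
    moreover have "1 \<in> sphere (0::complex) 1" "- 1 \<in> sphere (0::complex) 1" by auto
    ultimately show False by (metis empty_iff singletonD one_neq_neg_one)
  qed
  then have B0: "B \<noteq> 0" using nA by auto
  define t3 where "t3 = - (A / B)"
  have t3: "norm t3 = 1" using nA A0 by (simp add: t3_def norm_divide)
  have At3: "A = - t3 * B" using B0 by (simp add: t3_def)
  obtain a1 a2 where da: "((\<lambda>w. poly2 m n a (fst w) (snd w)) has_derivative (\<lambda>v. a1 * fst v + a2 * snd v)) (at (t1, t2))"
    using poly2_has_derivative_ex by blast
  obtain b1 b2 where db: "((\<lambda>w. poly2 m n b (fst w) (snd w)) has_derivative (\<lambda>v. b1 * fst v + b2 * snd v)) (at (t1, t2))"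
    using poly2_has_derivative_ex by blast
  obtain c1 c2 where dc: "((\<lambda>w. poly2 m n (refl2 m n b) (fst w) (snd w)) has_derivative (\<lambda>v. c1 * fst v + c2 * snd v)) (at (t1, t2))"
    using poly2_has_derivative_ex by blast
  obtain l1 l2 where dqt: "((\<lambda>w. poly2 m n (refl2 m n ?q) (fst w) (snd w)) has_derivative (\<lambda>v. l1 * fst v + l2 * snd v)) (at (t1, t2))"
    using poly2_has_derivative_ex by blast
  have dla: "((\<lambda>w. lam * poly2 m n a (fst w) (snd w)) has_derivative (\<lambda>v. (lam * a1) * fst v + (lam * a2) * snd v)) (at (t1, t2))"
    by (rule has_derivative_eq_rhs[OF has_derivative_mult_right[OF da]]) (simp add: algebra_simps)
  have dtb: "((\<lambda>w. - t3 * poly2 m n b (fst w) (snd w)) has_derivative (\<lambda>v. (- t3 * b1) * fst v + (- t3 * b2) * snd v)) (at (t1, t2))"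
    by (rule has_derivative_eq_rhs[OF has_derivative_mult_right[OF db]]) (simp add: algebra_simps)
  have dlqt: "((\<lambda>w. - lam * poly2 m n (refl2 m n ?q) (fst w) (snd w)) has_derivative (\<lambda>v. (- lam * l1) * fst v + (- lam * l2) * snd v)) (at (t1, t2))"
    by (rule has_derivative_eq_rhs[OF has_derivative_mult_right[OF dqt]]) (simp add: algebra_simps)
  define k1 k2 where "k1 = lam * a1 - c1" and "k2 = lam * a2 - c2"
  have dq: "((\<lambda>w. poly2 m n ?q (fst w) (snd w)) has_derivative (\<lambda>v. k1 * fst v + k2 * snd v)) (at (t1, t2))"
    unfolding poly2_qcoef k1_def k2_def
    by (rule has_derivative_eq_rhs[OF has_derivative_diff[OF dla dc]]) (simp add: algebra_simps)

  \<comment> \<open>Contact of \<open>p1\<close> with \<open>- t3 * p2\<close>: the scaled partial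
    derivatives of \<open>p\<close> in \<open>z1\<close> and \<open>z2\<close> are nonnegative
    multiples of the one in \<open>z3\<close>.\<close>
  have "\<exists>r\<ge>0. cnj A * (t1 * (a1 - (- t3 * b1))) = - of_real r" "\<exists>r\<ge>0. cnj A * (t2 * (a2 - (- t3 * b2))) = - of_real r"
    using contact_derivative[OF da dtb t] p2_le_p1 At3 t3 by (simp_all add: AB norm_mult)
  then obtain r1 r2 where r: "r1 \<ge> 0" "r2 \<ge> 0"
     "cnj (t3 * B) * (t1 * (a1 + t3 * b1)) = of_real r1" "cnj (t3 * B) * (t2 * (a2 + t3 * b2)) = of_real r2"
    unfolding At3 by (auto simp: minus_equation_iff[of _ "of_real _"])

  \<comment> \<open>Contact of \<open>lam * p1\<close> with \<open>p2~\<close>, whose difference is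
    \<open>q\<close>. It makes the products with the gradient of \<open>q\<close> real.\<close>
  have "\<exists>r\<ge>0. cnj (lam * A) * (t1 * k1) = - of_real r" "\<exists>r\<ge>0. cnj (lam * A) * (t2 * k2) = - of_real r"
    using contact_derivative[OF dla dc t] p2_refl_le_p1 lA lam
    unfolding k1_def k2_def by (simp_all add: AB norm_mult)
  then have real: "cnj (cnj (lam * A) * (t1 * k1)) = cnj (lam * A) * (t1 * k1)"
      "cnj (cnj (lam * A) * (t2 * k2)) = cnj (lam * A) * (t2 * k2)"
    by fastforce+
  have Atr: "At = t1 ^ m * t2 ^ n * cnj A"
    unfolding AB by (rule poly2_refl2_torus[OF t])
  \<comment> \<open>Reality removes the conjugate from the reflection identity. The resulting
    equation cancels the \<open>z1\<close> and \<open>z2\<close> derivatives of the pencil; its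
    \<open>z3\<close> derivative vanishes because \<open>q~\<close> does.\<close>
  have kl: "k = t3 * lam * l"
    if "s * l = - (t1 ^ m * t2 ^ n * cnj (s * k))" "cnj (cnj (lam * A) * (s * k)) = cnj (lam * A) * (s * k)" "norm s = 1"
    for s k l
  proof -
    have "(lam * A) * (s * (t3 * lam * l)) = t3 * lam * (lam * A) * (s * l)" by simp
    also have "\<dots> = - t3 * lam * (t1 ^ m * t2 ^ n) * (lam * A * cnj (s * k))"
      unfolding that(1) by simp
    also have "lam * A * cnj (s * k) = cnj (lam * A) * (s * k)" using that(2) by simp
    also have "- t3 * lam * (t1 ^ m * t2 ^ n) * (cnj (lam * A) * (s * k)) = - t3 * (lam * cnj lam) * At * (s * k)"
      by (simp add: Atr)
    also have "\<dots> = (lam * A) * (s * k)" by (simp add: ll At At3)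
    finally show ?thesis using A0 lam that(3) by auto
  qed
  have k: "k1 = t3 * lam * l1" "k2 = t3 * lam * l2"
    using refl2_derivative[OF dq dqt t q0] kl real t by blast+

  have "has_nt_limit (\<lambda>z. pPt m n a b z / pP m n a b z) (t1, t2, t3) lam"
  proof (rule has_nt_limit_level)
    show "(pP m n a b has_derivative (\<lambda>v. (a1 + t3 * b1) * fst v + (a2 + t3 * b2) * fst (snd v) + B * snd (snd v))) (at (t1, t2, t3))"
      unfolding pP_def AB by (rule pencil_has_derivative[OF da db])
    show "((\<lambda>z. lam * pP m n a b z - pPt m n a b z) has_derivative (\<lambda>v. 0)) (at (t1, t2, t3))"
      unfolding level_set_pencil[OF lam]
      by (rule has_derivative_eq_rhs[OF pencil_has_derivative[OF dq dlqt]]) (simp add: k qt0)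
    show "pP m n a b (t1, t2, t3) = 0" using At3 by (simp add: pz)
    show "pPt m n a b (t1, t2, t3) = 0" using lA At At3 by (simp add: pPt_def flip: AB) (simp flip: lA)
  qed (use zero_free t t3 B0 r in auto)
  moreover have "pP m n a b (t1, t2, t3) = 0" using At3 by (simp add: pz)
  ultimately show ?thesis using that t3 by blast
qed

text \<open>The ray identities for \<open>k = 1\<close> and \<open>k = 2\<close> differ by the
  \<open>z3\<close> term of the gradient, a nonzero multiple of \<open>q~\<close>. Then
  \<open>q\<close> vanishes as well, having the same modulus on the 2-torus.\<close>

lemma nt_limit_singular_point:
  assumes lam: "norm lam = 1" and t: "norm t1 = 1" "norm t2 = 1" "norm t3 = 1"
    and p0: "pP m n a b (t1, t2, t3) = 0"
    and lim: "has_nt_limit (\<lambda>z. pPt m n a b z / pP m n a b z) (t1, t2, t3) lam"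
  shows "poly2 m n (qcoef m n a b lam) t1 t2 = 0"
    and "poly2 m n (refl2 m n (qcoef m n a b lam)) t1 t2 = 0"
proof -
  let ?q = "qcoef m n a b lam"
  obtain \<alpha>1 \<alpha>2 where dp: "(pP m n a b has_derivative
     (\<lambda>v. \<alpha>1 * fst v + \<alpha>2 * fst (snd v) + poly2 m n b t1 t2 * snd (snd v))) (at (t1, t2, t3))"
    using pP_has_derivative_ex by blast
  obtain k1 k2 where dq: "((\<lambda>w. poly2 m n ?q (fst w) (snd w)) has_derivative (\<lambda>v. k1 * fst v + k2 * snd v)) (at (t1, t2))"
    using poly2_has_derivative_ex by blast
  obtain l1 l2 where dqt: "((\<lambda>w. poly2 m n (refl2 m n ?q) (fst w) (snd w)) has_derivative (\<lambda>v. l1 * fst v + l2 * snd v)) (at (t1, t2))"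
    using poly2_has_derivative_ex by blast
  have dlqt: "((\<lambda>w. - lam * poly2 m n (refl2 m n ?q) (fst w) (snd w)) has_derivative (\<lambda>v. (- lam * l1) * fst v + (- lam * l2) * snd v)) (at (t1, t2))"
    by (rule has_derivative_eq_rhs[OF has_derivative_mult_right[OF dqt]]) (simp add: algebra_simps)
  note dN = pencil_has_derivative[OF dq dlqt, of t3, folded level_set_pencil[OF lam]]
  let ?\<nu> = "\<lambda>k. (k1 + t3 * (- lam * l1)) * t1 + (k2 + t3 * (- lam * l2)) * t2
      + of_real k * (- lam * poly2 m n (refl2 m n ?q) t1 t2) * t3"
  have "?\<nu> 1 = 0" "?\<nu> 2 = 0"
    by (rule nt_limit_ray[OF zero_free dp dN t p0 lim]; simp)+
  moreover have "lam * poly2 m n (refl2 m n ?q) t1 t2 * t3 = ?\<nu> 1 - ?\<nu> 2"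
    by (simp add: algebra_simps)
  ultimately have "lam * poly2 m n (refl2 m n ?q) t1 t2 * t3 = 0" by (simp only: diff_zero)
  then show qt0: "poly2 m n (refl2 m n ?q) t1 t2 = 0" using lam t by auto
  then show "poly2 m n ?q t1 t2 = 0"
    using norm_poly2_refl2_torus[OF t(1,2), of m n ?q] by simp
qed

end

section \<open>Singularities and continuity of \<open>1/\<Psi> = \<lambda> q~ / q\<close>\<close>

theorem theorem4p8:
  fixes m n :: nat and a b :: "nat \<Rightarrow> nat \<Rightarrow> complex" and lam :: complex
  assumes zero_free: "\<forall>z\<in>polydisc3. pP m n a b z \<noteq> 0"
    and irred: "poly3_irreducible (pP m n a b)"
    and coprime: "poly3_no_common_factor (pP m n a b) (pPt m n a b)"
    and fin: "finite {\<tau> \<in> torus3. pP m n a b \<tau> = 0}"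
    and lam: "norm lam = 1"
  shows "(\<forall>\<tau>\<in>torus3. pP m n a b \<tau> = 0 \<and>
             has_nt_limit (\<lambda>z. pPt m n a b z / pP m n a b z) \<tau> lam \<longrightarrow>
             poly2 m n (qcoef m n a b lam) (fst \<tau>) (fst (snd \<tau>)) = 0 \<and>
             poly2 m n (refl2 m n (qcoef m n a b lam)) (fst \<tau>) (fst (snd \<tau>)) = 0)
       \<and> ((\<not> (\<exists>\<tau>\<in>torus3. pP m n a b \<tau> = 0 \<and>
               has_nt_limit (\<lambda>z. pPt m n a b z / pP m n a b z) \<tau> lam)) \<longrightarrow>
           (\<exists>F. continuous_on closed_bidisc F \<and>
                (\<forall>w\<in>closed_bidisc. poly2 m n (qcoef m n a b lam) (fst w) (snd w) \<noteq> 0 \<longrightarrow>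
                   F w = lam * poly2 m n (refl2 m n (qcoef m n a b lam)) (fst w) (snd w)
                         / poly2 m n (qcoef m n a b lam) (fst w) (snd w))))"
proof (intro conjI ballI impI)
  fix \<tau> assume \<tau>: "\<tau> \<in> torus3" "pP m n a b \<tau> = 0 \<and> has_nt_limit (\<lambda>z. pPt m n a b z / pP m n a b z) \<tau> lam"
  obtain t1 t2 t3 where [simp]: "\<tau> = (t1, t2, t3)" by (cases \<tau>)
  show "poly2 m n (qcoef m n a b lam) (fst \<tau>) (fst (snd \<tau>)) = 0"
    and "poly2 m n (refl2 m n (qcoef m n a b lam)) (fst \<tau>) (fst (snd \<tau>)) = 0"
    using nt_limit_singular_point[of m n a b lam t1 t2 t3] \<tau> zero_free lam by (auto simp: torus3_def)
next
  assume no: "\<not> (\<exists>\<tau>\<in>torus3. pP m n a b \<tau> = 0 \<and> has_nt_limit (\<lambda>z. pPt m n a b z / pP m n a b z) \<tau> lam)"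
  have torus: "poly2 m n (qcoef m n a b lam) z w \<noteq> 0" if zw: "norm z = 1" "norm w = 1" for z w
  proof
    assume "poly2 m n (qcoef m n a b lam) z w = 0"
    with zero_free fin lam zw obtain t3 where "norm t3 = 1" "pP m n a b (z, w, t3) = 0"
      "has_nt_limit (\<lambda>z. pPt m n a b z / pP m n a b z) (z, w, t3) lam"
      using singular_point_nt_limit[of m n a b lam z w] by blast
    then show False using no zw by (auto simp: torus3_def)
  qed
  \<comment> \<open>These are the coefficients of \<open>\<lambda> p1\<close>, so that
    \<open>q\<close> becomes the difference of a zero-free polynomial and the dominated
    \<open>p2~\<close>.\<close>
  define c where "c = (\<lambda>i j. lam * a i j)"
  have c: "poly2 m n c z w = lam * poly2 m n a z w" for z w
    unfolding poly2_def c_def by (simp add: sum_distrib_left mult.assoc)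
  have "poly2 m n c z w \<noteq> poly2 m n (refl2 m n b) z w" if "norm z \<le> 1" "norm w \<le> 1" for z w
  proof (rule no_zero_closed_bidisc)
    show "poly2 m n c z w \<noteq> 0" if "norm z < 1" "norm w < 1" for z w
      using p1_nonzero[of m n a b z w] zero_free lam that by (auto simp: c)
    show "norm (poly2 m n (refl2 m n b) z w) \<le> norm (poly2 m n c z w)" if "norm z < 1" "norm w < 1" for z w
      using p2_refl_le_p1[of m n a b z w] zero_free lam that by (auto simp: c norm_mult)
    show "poly2 m n c z w \<noteq> poly2 m n (refl2 m n b) z w" if "norm z = 1" "norm w = 1" for z w
      using torus[OF that] by (simp add: c poly2_qcoef)
  qed (use that in auto)
  \<comment> \<open>With \<open>q\<close> zero-free on the closed bidisc, the quotient itself serves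
    as \<open>F\<close>.\<close>
  then have "poly2 m n (qcoef m n a b lam) (fst w) (snd w) \<noteq> 0" if "w \<in> closed_bidisc" for w
    using that by (auto simp: closed_bidisc_def c poly2_qcoef)
  then have "continuous_on closed_bidisc (\<lambda>w. lam * poly2 m n (refl2 m n (qcoef m n a b lam)) (fst w) (snd w)
                         / poly2 m n (qcoef m n a b lam) (fst w) (snd w))"
    by (intro continuous_intros) auto
  then show "\<exists>F. continuous_on closed_bidisc F \<and>
                (\<forall>w\<in>closed_bidisc. poly2 m n (qcoef m n a b lam) (fst w) (snd w) \<noteq> 0 \<longrightarrow>
                   F w = lam * poly2 m n (refl2 m n (qcoef m n a b lam)) (fst w) (snd w)
                         / poly2 m n (qcoef m n a b lam) (fst w) (snd w))"
    by blast
qed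

end
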